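(* Let $G$ be a finite abstract simplicial complex and let $m\ge 1$ and $k\ge 1$ be integers. For $X=(x_1,\dots,x_k)\in G^k$ put $g_m(X)=w(X)\,w_m(U(X))$, where $w(X)=\prod_{j=1}^k w(x_j)$ and $U(X)=\bigcap_{j=1}^k U(x_j)$. Then $$ w_m(G)=\sum_{X\in G^k} g_m(X)=\sum_{(x_1,\dots,x_k)\in G^k}\Big(\prod_{j=1}^k w(x_j)\Big)\, w_m\Big(\bigcap_{j=1}^k U(x_j)\Big). $$
   Context: A finite abstract simplicial complex $G$ is a finite set of non-empty finite sets, closed under taking non-empty subsets. For $x\in G$, $\dim(x)=|x|-1$ and $w(x)=(-1)^{\dim(x)}$. The star of $x\in G$ is $U(x)=\{y\in G : x\subseteq y\}$. For any subset $A\subseteq G$ and any integer $m\ge1$, the $m$-th characteristic of $A$ is $$ w_m(A)=\sum_{(x_1,\dots,x_m)\in A^m,\ x_1\cap\cdots\cap x_m\in A}\ \prod_{j=1}^m w(x_j), $$ an integer (with $w_m(\emptyset)=0$). *)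

theory Defs
  imports Main "HOL-Library.FuncSet"
begin

definition simplicial_complex :: "'a set set \<Rightarrow> bool" where
  "simplicial_complex G \<longleftrightarrow>
     finite G \<and> (\<forall>x\<in>G. finite x \<and> x \<noteq> {}) \<and>
     (\<forall>x\<in>G. \<forall>y. y \<subseteq> x \<and> y \<noteq> {} \<longrightarrow> y \<in> G)"

(* Only used for nonempty finite x, where the subtraction does not truncate. *)
definition simplex_dim :: "'a set \<Rightarrow> nat" where
  "simplex_dim x = card x - 1"

definition w :: "'a set \<Rightarrow> int" where
  "w x = (- 1) ^ simplex_dim x"

definition star :: "'a set set \<Rightarrow> 'a set \<Rightarrow> 'a set set" where
  "star G x = {y \<in> G. x \<subseteq> y}"

(* A tuple in A^n is an extensional function on the index set {1..n}. *)
definition tuples :: "nat \<Rightarrow> 'b set \<Rightarrow> (nat \<Rightarrow> 'b) set" where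
  "tuples n A = {1..n} \<rightarrow>\<^sub>E A"

definition characteristic :: "nat \<Rightarrow> 'a set set \<Rightarrow> int" where
  "characteristic m A =
     (\<Sum>X \<in> {X \<in> tuples m A. (\<Inter>j\<in>{1..m}. X j) \<in> A}. \<Prod>j=1..m. w (X j))"

definition w_tuple :: "nat \<Rightarrow> (nat \<Rightarrow> 'a set) \<Rightarrow> int" where
  "w_tuple k X = (\<Prod>j=1..k. w (X j))"

definition star_tuple :: "'a set set \<Rightarrow> nat \<Rightarrow> (nat \<Rightarrow> 'a set) \<Rightarrow> 'a set set" where
  "star_tuple G k X = (\<Inter>j\<in>{1..k}. star G (X j))"

definition g :: "'a set set \<Rightarrow> nat \<Rightarrow> nat \<Rightarrow> (nat \<Rightarrow> 'a set) \<Rightarrow> int" where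
  "g G m k X = w_tuple k X * characteristic m (star_tuple G k X)"

end

theory Submission
  imports Defs
begin

text \<open>
  Expanding \<open>w\<^sub>m(U(X))\<close> and exchanging the two summations, a tuple \<open>(y\<^sub>1, \<dots>, y\<^sub>m)\<close> with
  intersection \<open>z \<in> G\<close> contributes its weight times the sum of \<open>w(X)\<close> over all tuples
  \<open>X\<close> of nonempty faces of \<open>z\<close>. That inner sum is the \<open>k\<close>-th power of the Euler
  characteristic of the simplex \<open>z\<close>, which is \<open>1\<close>.
\<close>

text \<open>Expanding the product of \<open>1 - 1\<close> over the points of \<open>z\<close> gives
  a vanishing alternating sum over all subsets; dropping the empty set leaves -1.\<close>

lemma sum_w_nonempty_subsets:
  assumes "finite z" "z \<noteq> {}"
  shows "(\<Sum>x \<in> Pow z - {{}}. w x) = 1"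
proof -
  have "(\<Sum>x\<in>Pow z. (- 1) ^ card x) = (0::int)"
    using prod_diff_conv_sum[of z "\<lambda>_. 1::int" "\<lambda>_. 1"] assms by (simp add: power_0_left)
  then have "(\<Sum>x\<in>Pow z - {{}}. (- 1) ^ card x) = (-1::int)"
    using assms by (simp add: sum_diff1)
  \<comment> \<open>Dimension is cardinality minus one, hence the sign flip; \<open>x\<close> must
    be nonempty, as the subtraction truncates at 0.\<close>
  moreover have "w x = - ((- 1) ^ card x)" if "x \<in> Pow z - {{}}" for x
  proof -
    have "card x \<noteq> 0" using that assms finite_subset by fastforce
    then show ?thesis by (cases "card x") (auto simp: w_def simplex_dim_def)
  qed
  ultimately show ?thesis by (simp add: sum_negf)
qed

lemma finite_tuples: "finite A \<Longrightarrow> finite (tuples n A)"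
  by (simp add: tuples_def finite_PiE)

lemma sum_w_tuple_faces:
  assumes G: "simplicial_complex G" and z: "z \<in> G"
  shows "(\<Sum>X \<in> {X \<in> tuples k G. \<forall>j\<in>{1..k}. X j \<subseteq> z}. w_tuple k X) = 1"
proof -
  \<comment> \<open>Closure of \<open>G\<close> under nonempty subsets turns the index set into a
    full product, so the sum factors.\<close>
  have faces: "{X \<in> tuples k G. \<forall>j\<in>{1..k}. X j \<subseteq> z} = {1..k} \<rightarrow>\<^sub>E (Pow z - {{}})"
  proof -
    have "x \<in> Pow z - {{}} \<longleftrightarrow> x \<in> G \<and> x \<subseteq> z" for x
      using G z unfolding simplicial_complex_def by blast
    then have "X \<in> {1..k} \<rightarrow>\<^sub>E (Pow z - {{}}) \<longleftrightarrow> X \<in> tuples k G \<and> (\<forall>j\<in>{1..k}. X j \<subseteq> z)" for X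
      by (simp only: tuples_def PiE_iff ball_conj_distrib conj_ac)
    then show ?thesis by (simp only: set_eq_iff mem_Collect_eq simp_thms)
  qed
  have "finite z" "z \<noteq> {}" using G z by (auto simp: simplicial_complex_def)
  then have "(\<Sum>X \<in> {1..k} \<rightarrow>\<^sub>E (Pow z - {{}}). w_tuple k X)
      = (\<Prod>j=1..k. \<Sum>x \<in> Pow z - {{}}. w x)"
    unfolding w_tuple_def by (subst prod_sum_PiE) auto
  with faces show ?thesis
    using \<open>finite z\<close> \<open>z \<noteq> {}\<close> by (simp add: sum_w_nonempty_subsets)
qed

text \<open>For \<open>k = 0\<close> the empty intersection would be \<open>UNIV\<close> instead of
  \<open>G\<close>.\<close>

lemma star_tuple_eq:
  assumes "k \<ge> 1"
  shows "star_tuple G k X = {y \<in> G. \<forall>j\<in>{1..k}. X j \<subseteq> y}"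
  using assms by (fastforce simp: star_tuple_def star_def)

text \<open>Each \<open>Y i\<close> contains the intersection of all of them, so once that
  intersection lies above every \<open>X j\<close>, so does each \<open>Y i\<close>. The nested
  filter has the shape that \<open>sum.swap_restrict\<close> expects.\<close>

lemma characteristic_star_tuple:
  assumes "k \<ge> 1"
  shows "characteristic m (star_tuple G k X) =
    (\<Sum>Y \<in> {Y \<in> {Y \<in> tuples m G. (\<Inter>i\<in>{1..m}. Y i) \<in> G}.
        \<forall>j\<in>{1..k}. X j \<subseteq> (\<Inter>i\<in>{1..m}. Y i)}. w_tuple m Y)"
proof -
  have "{Y \<in> tuples m (star_tuple G k X). (\<Inter>i\<in>{1..m}. Y i) \<in> star_tuple G k X} =
    {Y \<in> {Y \<in> tuples m G. (\<Inter>i\<in>{1..m}. Y i) \<in> G}.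
        \<forall>j\<in>{1..k}. X j \<subseteq> (\<Inter>i\<in>{1..m}. Y i)}"
    unfolding star_tuple_eq[OF assms] tuples_def PiE_iff by blast
  then show ?thesis by (simp only: characteristic_def w_tuple_def)
qed

theorem theorem1:
  fixes G :: "'a set set" and m k :: nat
  assumes "simplicial_complex G" and "m \<ge> 1" and "k \<ge> 1"
  shows "characteristic m G = (\<Sum>X \<in> tuples k G. g G m k X) \<and>
    (\<Sum>X \<in> tuples k G. g G m k X) =
      (\<Sum>X \<in> tuples k G. (\<Prod>j=1..k. w (X j)) *
         characteristic m (\<Inter>j\<in>{1..k}. star G (X j)))"
proof
  let ?T = "{Y \<in> tuples m G. (\<Inter>i\<in>{1..m}. Y i) \<in> G}"
  have "finite G" using assms(1) by (simp add: simplicial_complex_def)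
  then have fin: "finite (tuples k G)" "finite ?T" by (simp_all add: finite_tuples)
  have "(\<Sum>X \<in> tuples k G. g G m k X) =
      (\<Sum>X \<in> tuples k G. \<Sum>Y \<in> {Y \<in> ?T. \<forall>j\<in>{1..k}. X j \<subseteq> (\<Inter>i\<in>{1..m}. Y i)}.
        w_tuple k X * w_tuple m Y)"
    by (simp only: g_def characteristic_star_tuple[OF assms(3)] sum_distrib_left)
  also have "\<dots> = (\<Sum>Y \<in> ?T. \<Sum>X \<in> {X \<in> tuples k G. \<forall>j\<in>{1..k}. X j \<subseteq> (\<Inter>i\<in>{1..m}. Y i)}.
        w_tuple k X * w_tuple m Y)"
    by (rule sum.swap_restrict[OF fin])
  also have "\<dots> = (\<Sum>Y \<in> ?T. w_tuple m Y)"
  proof (rule sum.cong)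
    fix Y assume "Y \<in> ?T"
    then have "(\<Inter>i\<in>{1..m}. Y i) \<in> G" by blast
    \<comment> \<open>The intersection of the \<open>Y i\<close> serves as \<open>z\<close>;
      \<open>w_tuple m Y\<close> does not depend on \<open>X\<close> and factors out.\<close>
    from sum_w_tuple_faces[OF assms(1) this, of k]
    show "(\<Sum>X \<in> {X \<in> tuples k G. \<forall>j\<in>{1..k}. X j \<subseteq> (\<Inter>i\<in>{1..m}. Y i)}.
        w_tuple k X * w_tuple m Y) = w_tuple m Y"
      by (simp only: sum_distrib_right[symmetric] mult_1)
  qed simp
  finally show "characteristic m G = (\<Sum>X \<in> tuples k G. g G m k X)"
    by (simp only: characteristic_def w_tuple_def)
qed (simp only: g_def w_tuple_def star_tuple_def)

end
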